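(* Let $R$ be an integral domain, with $G^\ast$, $B$, $[P]$, $B_{a,[p]}$ as defined in the context. Assume that ($D_1$) for each $a\in G^\ast$, the supremum of $\downarrow a\cap B$ in $G^\ast$ exists and $a=\bigvee(\downarrow a\cap B)$; and ($B_1$) $B_{a,[p]}$ is a finite set for all $[p]\in[P]$ and $a\in G^\ast$. For $a\in G^\ast$ and $[p]\in[P]$ put $v_{[p]}(a)=\max\{n\mid [p]^n\in\downarrow a\}$ if $B_{a,[p]}\neq\varnothing$, and $v_{[p]}(a)=0$ if $B_{a,[p]}=\varnothing$. Then for each $a\in G^\ast$, $$a=\bigvee_{[p]\in[P]}[p]^{v_{[p]}(a)}$$ uniquely; that is, the equality holds, and if $(n_{[p]})_{[p]\in[P]}$ is any family of nonnegative integers such that $a=\bigvee_{[p]\in[P]}[p]^{n_{[p]}}$ in $G^\ast$, then $n_{[p]}=v_{[p]}(a)$ for all $[p]\in[P]$.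
   Context: $R$ is an integral domain (commutative ring with $1\neq 0$, no zero divisors), $R^\ast=R\setminus\{0\}$, $U$ is the group of units of $R$, and $G^\ast=R^\ast/U$ is the ordered monoid of classes $[x]$ ($x\in R^\ast$), with $[x][y]=[xy]$ and $[x]\leqslant[y]$ iff $x$ divides $y$ in $R$. $\bigvee$ denotes supremum in $G^\ast$ with respect to $\leqslant$. For $a\in G^\ast$, $\downarrow a=\{c\in G^\ast\mid c\leqslant a\}$. $P$ is the set of prime elements of $R$, $[P]=\{[p]\mid p\in P\}$, $B=\{[p]^n\mid p\in P,\ n=1,2,\dots\}$, and $B_{a,[p]}=\{[p]^n\in B\mid [p]^n\in\downarrow a\}$. *)

theory Defs
  imports "HOL-Library.Lub_Glb" "HOL-Computational_Algebra.Factorial_Ring"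
begin

definition unit_rel :: "'a::idom \<Rightarrow> 'a \<Rightarrow> bool" where
  "unit_rel x y \<longleftrightarrow> x \<noteq> 0 \<and> y \<noteq> 0 \<and> (\<exists>u. u dvd 1 \<and> y = x * u)"

lemma unit_relI: "x \<noteq> 0 \<Longrightarrow> y \<noteq> 0 \<Longrightarrow> u dvd 1 \<Longrightarrow> y = x * u \<Longrightarrow> unit_rel x y"
  unfolding unit_rel_def by blast

lemma unit_rel_refl: "x \<noteq> 0 \<Longrightarrow> unit_rel x x"
  by (rule unit_relI[where u = 1]) simp_all

lemma unit_relE:
  assumes "unit_rel x y"
  obtains u where "x \<noteq> 0" "y \<noteq> 0" "u dvd 1" "y = x * u"
  using assms unfolding unit_rel_def by blast

lemma unit_rel_part_equivp: "part_equivp (unit_rel :: 'a::idom \<Rightarrow> 'a \<Rightarrow> bool)"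
proof (rule part_equivpI)
  show "\<exists>x::'a. unit_rel x x"
    by (rule exI[of _ 1], rule unit_rel_refl) simp
  show "symp (unit_rel :: 'a \<Rightarrow> 'a \<Rightarrow> bool)"
  proof (rule sympI)
    fix x y :: 'a
    assume "unit_rel x y"
    then obtain u where u: "x \<noteq> 0" "y \<noteq> 0" "u dvd 1" "y = x * u" by (rule unit_relE)
    from u(3) obtain w where w: "1 = u * w" by (rule dvdE)
    have "x = y * w" unfolding u(4) mult.assoc w[symmetric] by simp
    moreover have "w dvd 1" unfolding w by (rule dvd_triv_right)
    ultimately show "unit_rel y x" using u(1,2) by (intro unit_relI)
  qed
  show "transp (unit_rel :: 'a \<Rightarrow> 'a \<Rightarrow> bool)"
  proof (rule transpI)
    fix x y z :: 'a
    assume xy: "unit_rel x y" and yz: "unit_rel y z"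
    from xy obtain u where u: "x \<noteq> 0" "y \<noteq> 0" "u dvd 1" "y = x * u" by (rule unit_relE)
    from yz obtain w where w: "y \<noteq> 0" "z \<noteq> 0" "w dvd 1" "z = y * w" by (rule unit_relE)
    have "u * w dvd 1" using mult_dvd_mono[OF u(3) w(3)] by simp
    moreover have "z = x * (u * w)" unfolding w(4) u(4) by (rule mult.assoc)
    ultimately show "unit_rel x z" using u(1) w(2) by (intro unit_relI)
  qed
qed

lemma unit_rel_imp_dvd:
  assumes "unit_rel x y"
  shows "x dvd y" "y dvd x"
proof -
  show "x dvd y" using assms by (rule unit_relE) (rule dvdI)
  have "unit_rel y x" using unit_rel_part_equivp assms by (rule part_equivp_symp)
  then show "y dvd x" by (rule unit_relE) (rule dvdI)
qed

text \<open>
  The monoid of nonzero elements modulo units. The class of \<open>x\<close> is \<open>abs_gstar x\<close>; this is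
  meaningful only for \<open>x \<noteq> 0\<close>, since \<open>0\<close> is not in the domain of the partial quotient.
\<close>

quotient_type (overloaded) 'a gstar = "'a::idom" / partial: unit_rel
  by (rule unit_rel_part_equivp)

instantiation gstar :: (idom) comm_monoid_mult
begin

lift_definition one_gstar :: "'a gstar" is 1
  by (rule unit_rel_refl) simp

lift_definition times_gstar :: "'a gstar \<Rightarrow> 'a gstar \<Rightarrow> 'a gstar" is "(*)"
proof -
  fix x x' y y' :: 'a
  assume xx': "unit_rel x x'" and yy': "unit_rel y y'"
  from xx' obtain u where u: "x \<noteq> 0" "x' \<noteq> 0" "u dvd 1" "x' = x * u" by (rule unit_relE)
  from yy' obtain w where w: "y \<noteq> 0" "y' \<noteq> 0" "w dvd 1" "y' = y * w" by (rule unit_relE)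
  have "u * w dvd 1" using mult_dvd_mono[OF u(3) w(3)] by simp
  moreover have "x' * y' = x * y * (u * w)" unfolding u(4) w(4) by (simp only: ac_simps)
  moreover have "x * y \<noteq> 0" "x' * y' \<noteq> 0" using u(1,2) w(1,2) by simp_all
  ultimately show "unit_rel (x * y) (x' * y')" by (intro unit_relI)
qed

instance
proof
  fix a b c :: "'a gstar"
  show "a * b * c = a * (b * c)"
    by transfer (simp add: mult.assoc, rule unit_rel_refl, simp add: unit_rel_def)
  show "a * b = b * a"
    by transfer (simp add: mult.commute, rule unit_rel_refl, simp add: unit_rel_def)
  show "1 * a = a"
    by transfer simp
qed

end

instantiation gstar :: (idom) order
begin

lift_definition less_eq_gstar :: "'a gstar \<Rightarrow> 'a gstar \<Rightarrow> bool" is "(dvd)"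
  by (meson dvd_trans unit_rel_imp_dvd)

definition less_gstar :: "'a gstar \<Rightarrow> 'a gstar \<Rightarrow> bool" where
  "less_gstar a b \<longleftrightarrow> a \<le> b \<and> \<not> b \<le> a"

instance
proof
  fix a b c :: "'a gstar"
  show "a < b \<longleftrightarrow> a \<le> b \<and> \<not> b \<le> a" by (rule less_gstar_def)
  show "a \<le> a" by transfer simp
  show "a \<le> b \<Longrightarrow> b \<le> c \<Longrightarrow> a \<le> c" by transfer (rule dvd_trans)
  show "a \<le> b \<Longrightarrow> b \<le> a \<Longrightarrow> a = b"
  proof transfer
    fix x y :: 'a
    assume "unit_rel x x" "unit_rel y y" and dvd: "x dvd y" "y dvd x"
    then have nz: "x \<noteq> 0" "y \<noteq> 0" unfolding unit_rel_def by simp_all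
    from dvd(1) obtain u where u: "y = x * u" by (rule dvdE)
    from dvd(2) obtain w where w: "x = y * w" by (rule dvdE)
    have "x * (u * w) = x * 1" by (simp only: w[unfolded u mult.assoc, symmetric] mult_1_right)
    then have "1 = u * w" using nz(1) by simp
    then have "u dvd 1" by (rule dvdI)
    then show "unit_rel x y" using u nz by (intro unit_relI)
  qed
qed

end

definition prime_classes :: "'a::idom gstar set" where
  "prime_classes = {abs_gstar p | p. prime_elem p}"

definition prime_power_classes :: "'a::idom gstar set" where
  "prime_power_classes = {abs_gstar p ^ n | p n. prime_elem p \<and> 1 \<le> n}"

definition prime_powers_below :: "'a::idom gstar \<Rightarrow> 'a gstar \<Rightarrow> 'a gstar set" where
  "prime_powers_below a q = {q ^ n | n. q ^ n \<in> prime_power_classes \<and> q ^ n \<in> {..a}}"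

text \<open>
  \<open>Max\<close> is a genuine maximum only if the set is finite; for a prime class \<open>q\<close> this holds as soon as
  \<open>prime_powers_below a q\<close> is finite, because the powers of \<open>q\<close> are distinct.
\<close>

definition val :: "'a::idom gstar \<Rightarrow> 'a gstar \<Rightarrow> nat" where
  "val q a = (if prime_powers_below a q \<noteq> {} then Max {n. q ^ n \<in> {..a}} else 0)"

end

theory Submission
  imports Defs
begin

text \<open>
  Everything rests on one equivalence: for a prime class \<open>q\<close> with only finitely many powers below
  \<open>a\<close>, one has \<open>q ^ n \<le> a\<close> exactly when \<open>n \<le> val q a\<close> (\<open>power_le_iff_le_val\<close>). Hence the family
  \<open>q ^ val q a\<close> has the same upper bounds as the set of all prime powers below \<open>a\<close>, and the
  least of these is \<open>a\<close> by the first hypothesis.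

  For uniqueness, let \<open>a\<close> be the supremum of the powers \<open>q ^ n q\<close>. Each of them lies below \<open>a\<close>,
  so \<open>n q \<le> val q a\<close>. For the converse, let \<open>q ^ m \<le> a\<close> and split \<open>a = q ^ m * b\<close>. The element
  \<open>q ^ n q * b\<close> is again an upper bound of the family: the power of \<open>q\<close> itself is visibly below
  it, and the power of another prime class \<open>p\<close> divides \<open>q ^ m * b\<close> and so divides \<open>b\<close>, because
  \<open>p\<close> does not divide \<open>q\<close> (\<open>prime_class_power_le_times_power\<close>). So
  \<open>q ^ m * b = a \<le> q ^ n q * b\<close>, and cancelling \<open>b\<close> gives \<open>m \<le> n q\<close>.
\<close>

section \<open>Suprema and prime elements\<close>

lemma isLub_UNIV_iff:
  "isLub UNIV S a \<longleftrightarrow> (\<forall>x\<in>S. x \<le> a) \<and> (\<forall>c. (\<forall>x\<in>S. x \<le> c) \<longrightarrow> a \<le> c)"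
  by (auto simp: isLub_def leastP_def isUb_def setle_def setge_def)

lemma prime_elem_power_dvd_mult_cancel:
  fixes p x b :: "'a::idom"
  assumes p: "prime_elem p" and px: "\<not> p dvd x" and "p ^ n dvd x * b"
  shows "p ^ n dvd b"
  using assms(3)
proof (induction n arbitrary: b)
  case 0
  show ?case by simp
next
  case (Suc n)
  have "p dvd x * b"
    using Suc.prems by (rule dvd_trans[rotated]) simp
  then have "p dvd b"
    using p px by (auto dest: prime_elem_dvd_multD)
  then obtain c where b: "b = p * c" by (rule dvdE)
  have "p * p ^ n dvd p * (x * c)"
    using Suc.prems by (simp add: b ac_simps)
  then have "p ^ n dvd x * c"
    using prime_elem_not_zeroI[OF p] by simp
  then have "p ^ n dvd c" by (rule Suc.IH)
  then show ?case by (simp add: b)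
qed

text \<open>
  A prime element is irreducible, so the cofactor in \<open>q = p * r\<close> is a unit as soon as \<open>p\<close> is not.
\<close>

lemma prime_elem_dvd_prime_elem_sym:
  fixes p q :: "'a::idom"
  assumes p: "prime_elem p" and q: "prime_elem q" and "p dvd q"
  shows "q dvd p"
proof (rule ccontr)
  assume "\<not> q dvd p"
  obtain r where r: "q = p * r" using \<open>p dvd q\<close> by (rule dvdE)
  then have "q dvd p * r" by simp
  with \<open>\<not> q dvd p\<close> have "q dvd r"
    using q by (auto dest: prime_elem_dvd_multD)
  then obtain s where "r = q * s" by (rule dvdE)
  with r have "q * 1 = q * (p * s)" by (simp add: ac_simps)
  then have "1 = p * s"
    using prime_elem_not_zeroI[OF q] by (simp only: mult_cancel_left) simp
  then have "p dvd 1" by (rule dvdI)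
  with p show False by (simp add: prime_elem_def)
qed

section \<open>The ordered monoid of nonzero elements modulo units\<close>

lemma gstar_cases:
  obtains x where "x \<noteq> 0" "g = abs_gstar x"
  by (metis Quotient_abs_rep Quotient_gstar Quotient_rep_reflp unit_rel_def)

lemma abs_gstar_mult:
  "x \<noteq> 0 \<Longrightarrow> y \<noteq> 0 \<Longrightarrow> abs_gstar x * abs_gstar y = abs_gstar (x * y)"
  by (simp add: times_gstar.abs_eq unit_rel_refl)

lemma abs_gstar_power: "x \<noteq> 0 \<Longrightarrow> abs_gstar x ^ n = abs_gstar (x ^ n)"
  by (induction n) (simp_all add: abs_gstar_mult one_gstar_def)

lemma abs_gstar_le_iff:
  "x \<noteq> 0 \<Longrightarrow> y \<noteq> 0 \<Longrightarrow> abs_gstar x \<le> abs_gstar y \<longleftrightarrow> x dvd y"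
  by (simp add: less_eq_gstar.abs_eq unit_rel_refl)

text \<open>
  The order is defined on representatives; expressing it by the multiplication of classes lets one
  write an element as a prime power times a complementary class.
\<close>

lemma gstar_le_iff_dvd: "(a :: 'a::idom gstar) \<le> b \<longleftrightarrow> a dvd b"
proof -
  obtain x where x: "x \<noteq> 0" "a = abs_gstar x" by (rule gstar_cases)
  obtain y where y: "y \<noteq> 0" "b = abs_gstar y" by (rule gstar_cases)
  show ?thesis
  proof
    assume "a \<le> b"
    then have "x dvd y" by (simp add: x y abs_gstar_le_iff)
    then obtain z where z: "y = x * z" by (rule dvdE)
    with y have "b = a * abs_gstar z" by (simp add: x abs_gstar_mult)
    then show "a dvd b" by (rule dvdI)
  next
    assume "a dvd b"
    then obtain c where c: "b = a * c" by (rule dvdE)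
    obtain z where "z \<noteq> 0" "c = abs_gstar z" by (rule gstar_cases)
    with c show "a \<le> b" by (simp add: x abs_gstar_mult abs_gstar_le_iff)
  qed
qed

lemma gstar_mult_le_cancel_right:
  fixes a b c :: "'a::idom gstar"
  shows "a * c \<le> b * c \<longleftrightarrow> a \<le> b"
proof -
  obtain x where "x \<noteq> 0" "a = abs_gstar x" by (rule gstar_cases)
  moreover obtain y where "y \<noteq> 0" "b = abs_gstar y" by (rule gstar_cases)
  moreover obtain z where "z \<noteq> 0" "c = abs_gstar z" by (rule gstar_cases)
  ultimately show ?thesis by (simp add: abs_gstar_mult abs_gstar_le_iff)
qed

section \<open>Powers of prime classes\<close>

lemma prime_classes_cases:
  assumes "q \<in> prime_classes"
  obtains p where "prime_elem p" "p \<noteq> 0" "q = abs_gstar p"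
  using assms by (auto simp: prime_classes_def prime_elem_def)

lemma prime_class_power_in_prime_power_classes:
  "q \<in> prime_classes \<Longrightarrow> 1 \<le> n \<Longrightarrow> q ^ n \<in> prime_power_classes"
  unfolding prime_classes_def prime_power_classes_def by blast

lemma prime_power_classes_cases:
  assumes "x \<in> prime_power_classes"
  obtains q n where "q \<in> prime_classes" "x = q ^ n"
  using assms unfolding prime_classes_def prime_power_classes_def by blast

lemma prime_class_power_le_power_iff:
  assumes "q \<in> prime_classes"
  shows "q ^ m \<le> q ^ n \<longleftrightarrow> m \<le> n"
proof
  assume "m \<le> n"
  then show "q ^ m \<le> q ^ n" by (metis dvdI gstar_le_iff_dvd le_add_diff_inverse power_add)
next
  assume le: "q ^ m \<le> q ^ n"
  obtain p where p: "prime_elem p" "p \<noteq> 0" "q = abs_gstar p"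
    using assms by (rule prime_classes_cases)
  show "m \<le> n"
  proof (rule ccontr)
    assume "\<not> m \<le> n"
    then have "p ^ Suc n dvd p ^ m" by (intro le_imp_power_dvd) simp
    also have "p ^ m dvd p ^ n"
      using le p by (simp add: abs_gstar_power abs_gstar_le_iff)
    finally have "p ^ n * p dvd p ^ n * 1" by (simp add: mult.commute)
    then have "p dvd 1" using p(2) by (simp only: dvd_mult_cancel_left) simp
    with p(1) show False by (simp add: prime_elem_def)
  qed
qed

lemma prime_class_power_le_times_power:
  assumes p: "p \<in> prime_classes" and q: "q \<in> prime_classes" and "p \<noteq> q"
    and le: "p ^ k \<le> q ^ m * b"
  shows "p ^ k \<le> b"
proof -
  obtain x where x: "prime_elem x" "x \<noteq> 0" "p = abs_gstar x"
    using p by (rule prime_classes_cases)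
  obtain y where y: "prime_elem y" "y \<noteq> 0" "q = abs_gstar y"
    using q by (rule prime_classes_cases)
  obtain z where z: "z \<noteq> 0" "b = abs_gstar z" by (rule gstar_cases)
  have "\<not> x dvd y"
  proof
    assume "x dvd y"
    moreover from this have "y dvd x" by (rule prime_elem_dvd_prime_elem_sym[OF x(1) y(1)])
    ultimately have "p \<le> q" "q \<le> p" by (simp_all add: x y abs_gstar_le_iff)
    with \<open>p \<noteq> q\<close> show False by simp
  qed
  then have "\<not> x dvd y ^ m"
    using x(1) prime_elem_dvd_power by blast
  moreover have "x ^ k dvd y ^ m * z"
    using le x y z by (simp add: abs_gstar_power abs_gstar_mult abs_gstar_le_iff)
  ultimately have "x ^ k dvd z"
    by (rule prime_elem_power_dvd_mult_cancel[OF x(1)])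
  then show ?thesis
    using x z by (simp add: abs_gstar_power abs_gstar_le_iff)
qed

text \<open>
  Finiteness makes the maximum in \<open>val\<close> attained. It is stated for the set of powers, but passes to
  the set of exponents since the powers of a prime class are distinct; the exponent \<open>0\<close> is always
  admissible, although \<open>q ^ 0\<close> is not counted among the prime powers.
\<close>

lemma power_le_iff_le_val:
  assumes q: "q \<in> prime_classes" and fin: "finite (prime_powers_below a q)"
  shows "q ^ n \<le> a \<longleftrightarrow> n \<le> val q a"
proof (cases "prime_powers_below a q = {}")
  case True
  have "n = 0" if "q ^ n \<le> a"
    using that True prime_class_power_in_prime_power_classes[OF q, of n]
    by (cases n) (auto simp: prime_powers_below_def simp del: power_Suc)
  moreover have "q ^ 0 \<le> a" by (simp add: gstar_le_iff_dvd)
  ultimately show ?thesis using True by (auto simp: val_def)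
next
  case False
  let ?E = "{n. q ^ n \<le> a}"
  have "q ^ n \<in> insert 1 (prime_powers_below a q)" if "q ^ n \<le> a" for n
    using that prime_class_power_in_prime_power_classes[OF q, of n]
    by (cases "n = 0") (auto simp: prime_powers_below_def)
  then have "(\<lambda>n. q ^ n) ` ?E \<subseteq> insert 1 (prime_powers_below a q)" by auto
  then have "finite ((\<lambda>n. q ^ n) ` ?E)" using fin finite_subset by blast
  moreover have "inj_on (\<lambda>n. q ^ n) ?E"
  proof (rule inj_onI)
    fix m n
    assume "q ^ m = q ^ n"
    then have "q ^ m \<le> q ^ n" "q ^ n \<le> q ^ m" by simp_all
    then show "m = n" by (simp add: prime_class_power_le_power_iff[OF q])
  qed
  ultimately have finE: "finite ?E" by (rule finite_imageD)
  have "0 \<in> ?E" by (simp add: gstar_le_iff_dvd)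
  then have "?E \<noteq> {}" by blast
  with finE have "Max ?E \<in> ?E" by (rule Max_in)
  moreover have val: "val q a = Max ?E" using False by (simp add: val_def)
  ultimately have max: "q ^ val q a \<le> a" by simp
  show ?thesis
  proof
    assume "q ^ n \<le> a"
    then show "n \<le> val q a" using finE by (simp add: val)
  next
    assume "n \<le> val q a"
    then have "q ^ n \<le> q ^ val q a" by (simp add: prime_class_power_le_power_iff[OF q])
    then show "q ^ n \<le> a" using max by (rule order_trans)
  qed
qed

section \<open>Decomposition into prime powers\<close>

text \<open>
  A power of \<open>q\<close> below a supremum of prime powers is already accounted for by the exponent of \<open>q\<close>:
  otherwise, lowering the power of \<open>q\<close> in \<open>a\<close> would give a smaller upper bound.
\<close>

lemma exponent_le_if_isLub:
  assumes lub: "isLub UNIV ((\<lambda>q. q ^ n q) ` prime_classes) a"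
    and q: "q \<in> prime_classes" and "q ^ m \<le> a"
  shows "m \<le> n q"
proof -
  obtain b where a: "a = q ^ m * b"
    using \<open>q ^ m \<le> a\<close> unfolding gstar_le_iff_dvd by (rule dvdE)
  have "p ^ n p \<le> q ^ n q * b" if p: "p \<in> prime_classes" for p
  proof (cases "p = q")
    case True
    then show ?thesis by (simp add: gstar_le_iff_dvd)
  next
    case False
    have "p ^ n p \<le> q ^ m * b" using lub p by (simp add: isLub_UNIV_iff a)
    then have "p ^ n p \<le> b" by (rule prime_class_power_le_times_power[OF p q False])
    then show ?thesis by (simp add: gstar_le_iff_dvd)
  qed
  then have "q ^ m * b \<le> q ^ n q * b" using lub by (simp add: isLub_UNIV_iff a)
  then show ?thesis
    by (simp add: gstar_mult_le_cancel_right prime_class_power_le_power_iff[OF q])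
qed

theorem proposition2p6:
  fixes a :: "'a::idom gstar"
  assumes D1: "\<And>b :: 'a gstar. isLub UNIV ({..b} \<inter> prime_power_classes) b"
    and B1: "\<And>(b :: 'a gstar) q. q \<in> prime_classes \<Longrightarrow> finite (prime_powers_below b q)"
  shows "isLub UNIV ((\<lambda>q. q ^ val q a) ` prime_classes) a \<and>
    (\<forall>n :: 'a gstar \<Rightarrow> nat. isLub UNIV ((\<lambda>q. q ^ n q) ` prime_classes) a \<longrightarrow>
      (\<forall>q\<in>prime_classes. n q = val q a))"
proof (intro conjI allI impI ballI)
  have le_iff: "q ^ n \<le> a \<longleftrightarrow> n \<le> val q a" if "q \<in> prime_classes" for q n
    using that B1 by (intro power_le_iff_le_val)
  show "isLub UNIV ((\<lambda>q. q ^ val q a) ` prime_classes) a"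
    unfolding isLub_UNIV_iff
  proof (intro conjI allI impI)
    show "\<forall>x\<in>(\<lambda>q. q ^ val q a) ` prime_classes. x \<le> a" by (simp add: le_iff)
  next
    fix c
    assume c: "\<forall>x\<in>(\<lambda>q. q ^ val q a) ` prime_classes. x \<le> c"
    have "x \<le> c" if x_mem: "x \<in> {..a} \<inter> prime_power_classes" for x
    proof -
      obtain q n where q: "q \<in> prime_classes" and x: "x = q ^ n"
        using x_mem by (blast elim: prime_power_classes_cases)
      have "x \<le> q ^ val q a"
        using x_mem q by (simp add: x le_iff prime_class_power_le_power_iff)
      also have "\<dots> \<le> c" using c q by simp
      finally show ?thesis .
    qed
    with D1[of a] show "a \<le> c" by (simp add: isLub_UNIV_iff)
  qed
  fix n and q :: "'a gstar"
  assume lub: "isLub UNIV ((\<lambda>q. q ^ n q) ` prime_classes) a" and q: "q \<in> prime_classes"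
  show "n q = val q a"
  proof (rule antisym)
    show "n q \<le> val q a" using lub q by (simp add: isLub_UNIV_iff flip: le_iff)
    show "val q a \<le> n q" using lub q by (rule exponent_le_if_isLub) (simp add: le_iff q)
  qed
qed

end
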